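(* The hyperbolic dimension is a quasi-isometry invariant of metric spaces: if $X$ and $X'$ are quasi-isometric metric spaces, then $\operatorname{hypdim}X=\operatorname{hypdim}X'$.
   Context: Quasi-isometric spaces: $X$ and $X'$ are quasi-isometric if there is a map $f:X\to X'$ and $\Lambda\ge1$, $\lambda\ge0$ with $\frac1\Lambda|x-x'|-\lambda\le|f(x)-f(x')|\le\Lambda|x-x'|+\lambda$ for all $x,x'\in X$, such that every point of $X'$ is within a uniformly bounded distance of $f(X)$. Boundedness: let $\mathcal N$ be the set of functions $N:(0,1)\to\mathbb N$ and $\mathcal R$ the set of functions $R:(0,1)\to[0,\infty)$. A metric space $A$ (in particular a subset of a metric space, with the induced metric) is $(N,R)$-bounded if for every $\rho\in(0,1)$ every ball of radius $r\ge R(\rho)$ in $A$ contains at most $N(\rho)$ points which are $\rho r$-separated (pairwise distances $\ge\rho r$). It is $N$-bounded if it is $(N,R)$-bounded for some $R\in\mathcal R$. Uniformly $N$-bounded coverings: given $N\in\mathcal N$, a covering $\mathcal U$ of a metric space $X$ is uniformly $N$-bounded if (i) there is $R\in\mathcal R$ such that every element of $\mathcal U$ is $(N,R)$-bounded, and (ii) any finite union of elements of $\mathcal U$ is $N$-bounded. Lebesgue number: $L(\mathcal U)=\inf_{x\in X}\max\{\operatorname{dist}(x,X\setminus U): U\in\mathcal U\}$ (with $\operatorname{dist}(x,\emptyset)=\infty$). Hyperbolic dimension: $\operatorname{hypdim}X$ is the minimal integer $n\ge 0$ (or $\infty$ if there is none) such that for every $d>0$ there are a function $N\in\mathcal N$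 and a uniformly $N$-bounded covering $\mathcal U$ of $X$ with $L(\mathcal U)\ge d$ and multiplicity $\le n+1$ (every point lies in at most $n+1$ elements). *)

theory Defs
  imports "HOL-Analysis.Analysis" "HOL-Library.Extended_Nat"
begin

definition quasi_isometric ::
    "'a set \<Rightarrow> ('a \<Rightarrow> 'a \<Rightarrow> real) \<Rightarrow> 'b set \<Rightarrow> ('b \<Rightarrow> 'b \<Rightarrow> real) \<Rightarrow> bool" where
  "quasi_isometric X d X' d' \<longleftrightarrow>
     (\<exists>f L c. f \<in> X \<rightarrow> X' \<and> 1 \<le> L \<and> 0 \<le> c \<and>
        (\<forall>x\<in>X. \<forall>y\<in>X. (1 / L) * d x y - c \<le> d' (f x) (f y) \<and> d' (f x) (f y) \<le> L * d x y + c) \<and>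
        (\<exists>C. \<forall>x'\<in>X'. \<exists>x\<in>X. d' x' (f x) \<le> C))"

definition separated_by :: "('a \<Rightarrow> 'a \<Rightarrow> real) \<Rightarrow> real \<Rightarrow> 'a set \<Rightarrow> bool" where
  "separated_by d s S \<longleftrightarrow> pairwise (\<lambda>x y. s \<le> d x y) S"

text \<open>Functions on the interval \<open>(0,1)\<close> are represented by functions on \<^typ>\<open>real\<close>; only their
  values on \<^term>\<open>{0<..<1::real}\<close> are ever used. Balls are open, with centre in \<open>A\<close>, and are taken in
  the metric space \<open>A\<close> itself.\<close>

definition NR_bounded ::
    "(real \<Rightarrow> nat) \<Rightarrow> (real \<Rightarrow> real) \<Rightarrow> 'a set \<Rightarrow> ('a \<Rightarrow> 'a \<Rightarrow> real) \<Rightarrow> bool" where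
  "NR_bounded N R A d \<longleftrightarrow>
     (\<forall>\<rho>\<in>{0<..<1}. \<forall>a\<in>A. \<forall>r\<ge>R \<rho>. \<forall>S \<subseteq> Metric_space.mball A d a r.
        separated_by d (\<rho> * r) S \<longrightarrow> finite S \<and> card S \<le> N \<rho>)"

definition admissible_radii :: "(real \<Rightarrow> real) set" where
  "admissible_radii = {R. \<forall>\<rho>\<in>{0<..<1}. 0 \<le> R \<rho>}"

definition N_bounded :: "(real \<Rightarrow> nat) \<Rightarrow> 'a set \<Rightarrow> ('a \<Rightarrow> 'a \<Rightarrow> real) \<Rightarrow> bool" where
  "N_bounded N A d \<longleftrightarrow> (\<exists>R\<in>admissible_radii. NR_bounded N R A d)"

definition covering :: "'a set \<Rightarrow> 'a set set \<Rightarrow> bool" where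
  "covering X \<U> \<longleftrightarrow> \<U> \<subseteq> Pow X \<and> \<Union>\<U> = X"

definition uniformly_N_bounded_covering ::
    "(real \<Rightarrow> nat) \<Rightarrow> 'a set \<Rightarrow> ('a \<Rightarrow> 'a \<Rightarrow> real) \<Rightarrow> 'a set set \<Rightarrow> bool" where
  "uniformly_N_bounded_covering N X d \<U> \<longleftrightarrow>
     covering X \<U> \<and>
     (\<exists>R\<in>admissible_radii. \<forall>U\<in>\<U>. NR_bounded N R U d) \<and>
     (\<forall>\<V>\<subseteq>\<U>. finite \<V> \<longrightarrow> N_bounded N (\<Union>\<V>) d)"

text \<open>Values in \<^typ>\<open>ennreal\<close> make the distance to the empty set, an infimum over the empty set,
  equal to \<open>\<infinity>\<close>.\<close>

definition dist_to_set :: "('a \<Rightarrow> 'a \<Rightarrow> real) \<Rightarrow> 'a \<Rightarrow> 'a set \<Rightarrow> ennreal" where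
  "dist_to_set d x B = (INF y\<in>B. ennreal (d x y))"

text \<open>The maximum over the covering is written as a supremum: if every point lies in finitely many
  members of the covering, then only finitely many of the distances \<open>dist(x, X - U)\<close> are nonzero
  and the supremum is attained.\<close>

definition Lebesgue_num :: "'a set \<Rightarrow> ('a \<Rightarrow> 'a \<Rightarrow> real) \<Rightarrow> 'a set set \<Rightarrow> ennreal" where
  "Lebesgue_num X d \<U> = (INF x\<in>X. SUP U\<in>\<U>. dist_to_set d x (X - U))"

definition multiplicity_at_most :: "nat \<Rightarrow> 'a set \<Rightarrow> 'a set set \<Rightarrow> bool" where
  "multiplicity_at_most m X \<U> \<longleftrightarrow>
     (\<forall>x\<in>X. finite {U\<in>\<U>. x \<in> U} \<and> card {U\<in>\<U>. x \<in> U} \<le> m)"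

text \<open>The infimum of the empty set in \<^typ>\<open>enat\<close> is \<open>\<infinity>\<close>.\<close>

definition hypdim :: "'a set \<Rightarrow> ('a \<Rightarrow> 'a \<Rightarrow> real) \<Rightarrow> enat" where
  "hypdim X d = Inf {enat n | n. \<forall>\<delta>>0. \<exists>N \<U>.
     uniformly_N_bounded_covering N X d \<U> \<and>
     ennreal \<delta> \<le> Lebesgue_num X d \<U> \<and>
     multiplicity_at_most (n + 1) X \<U>}"

end

theory Submission
  imports Defs
begin

text \<open>A quasi-isometric embedding pulls coverings back: preimages keep the multiplicity, lose only
  a bounded factor in the Lebesgue number, and are \<open>N\<close>-bounded for an \<open>N\<close> that depends only on the
  constants of the map, because at large scales the additive constant is absorbed into the
  multiplicative one. A quasi-inverse then gives the reverse inequality.\<close>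

section \<open>Quasi-inverses\<close>

text \<open>A quasi-inverse \<open>g\<close> picks for each point of \<open>X'\<close> a point of
  \<open>X\<close> whose image is within \<open>C\<close> of it. Replacing \<open>x\<close> by
  \<open>f (g x)\<close> costs at most \<open>C\<close> per endpoint, so the estimates for
  \<open>f\<close> turn into estimates for \<open>g\<close>.\<close>

lemma quasi_isometric_sym:
  assumes "Metric_space X d" and "Metric_space X' d'" and "quasi_isometric X d X' d'"
  shows "quasi_isometric X' d' X d"
proof -
  interpret M: Metric_space X d by fact
  interpret M': Metric_space X' d' by fact
  obtain f L c C0 where f: "f \<in> X \<rightarrow> X'" and L: "1 \<le> L" and c: "0 \<le> c"
    and lower: "\<And>x y. x \<in> X \<Longrightarrow> y \<in> X \<Longrightarrow> (1 / L) * d x y - c \<le> d' (f x) (f y)"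
    and upper: "\<And>x y. x \<in> X \<Longrightarrow> y \<in> X \<Longrightarrow> d' (f x) (f y) \<le> L * d x y + c"
    and C0: "\<forall>x'\<in>X'. \<exists>x\<in>X. d' x' (f x) \<le> C0"
    using assms(3) unfolding quasi_isometric_def by blast
  \<comment> \<open>A negative \<open>C0\<close> is possible only for empty \<open>X'\<close>; the
    maximum covers that case.\<close>
  define C where "C = max C0 0"
  have C: "0 \<le> C" and "\<forall>x'\<in>X'. \<exists>x. x \<in> X \<and> d' x' (f x) \<le> C"
    using C0 unfolding C_def by (auto intro: max.coboundedI1)
  then obtain g where g: "\<And>x'. x' \<in> X' \<Longrightarrow> g x' \<in> X \<and> d' x' (f (g x')) \<le> C"
    by metis
  \<comment> \<open>One additive constant for both bounds: the upper one produces exactly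
    \<open>K\<close>, and the lower one needs \<open>c + 2 * C \<le> L * K\<close>, which follows
    from \<open>c + 2 * C \<le> K\<close> and \<open>1 \<le> L\<close>.\<close>
  define K where "K = L * (c + 2 * C)"
  have K: "0 \<le> K" "c + 2 * C \<le> K"
    using L c C mult_right_mono[of 1 L "c + 2 * C"] by (auto simp: K_def)
  have expand: "d x y \<le> L * (d' (f x) (f y) + c)" if "x \<in> X" "y \<in> X" for x y
    using lower[OF that] L by (simp add: field_simps)
  have g_upper: "d (g x) (g y) \<le> L * d' x y + K" if "x \<in> X'" "y \<in> X'" for x y
  proof -
    have mem: "f (g x) \<in> X'" "f (g y) \<in> X'"
      using f g that by auto
    have "d' (f (g x)) (f (g y)) \<le> d' (f (g x)) x + d' x y + d' y (f (g y))"
      using M'.triangle[of "f (g x)" x "f (g y)"] M'.triangle[of x y "f (g y)"] mem that by auto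
    also have "\<dots> \<le> d' x y + 2 * C"
      using g[OF that(1)] g[OF that(2)] M'.commute[of x "f (g x)"] by auto
    finally have "L * (d' (f (g x)) (f (g y)) + c) \<le> L * (d' x y + 2 * C + c)"
      using L by (intro mult_left_mono) auto
    then show ?thesis
      using expand[of "g x" "g y"] g that by (simp add: K_def algebra_simps)
  qed
  have g_lower: "(1 / L) * d' x y - K \<le> d (g x) (g y)" if "x \<in> X'" "y \<in> X'" for x y
  proof -
    have mem: "f (g x) \<in> X'" "f (g y) \<in> X'"
      using f g that by auto
    have "d' x y \<le> d' x (f (g x)) + d' (f (g x)) (f (g y)) + d' (f (g y)) y"
      using M'.triangle[of x "f (g x)" y] M'.triangle[of "f (g x)" "f (g y)" y] mem that by auto
    also have "\<dots> \<le> L * d (g x) (g y) + c + 2 * C"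
      using g[OF that(1)] g[OF that(2)] M'.commute[of y "f (g y)"] upper[of "g x" "g y"] by auto
    also have "\<dots> \<le> L * (d (g x) (g y) + K)"
      using K L mult_right_mono[of 1 L K] by (simp add: algebra_simps)
    finally show ?thesis
      using L by (simp add: field_simps)
  qed
  \<comment> \<open>Coarse density of the image of \<open>g\<close>: the witness for
    \<open>x\<close> is \<open>f x\<close>.\<close>
  have "\<exists>x'\<in>X'. d x (g x') \<le> L * (C + c)" if x: "x \<in> X" for x
  proof (intro bexI)
    show fx: "f x \<in> X'"
      using f x by auto
    have "d x (g (f x)) \<le> L * (d' (f x) (f (g (f x))) + c)"
      using expand x g[OF fx] by auto
    also have "\<dots> \<le> L * (C + c)"
      using g[OF fx] L by (intro mult_left_mono) auto
    finally show "d x (g (f x)) \<le> L * (C + c)" .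
  qed
  moreover have "g \<in> X' \<rightarrow> X"
    using g by auto
  ultimately show ?thesis
    using L K(1) g_upper g_lower unfolding quasi_isometric_def by blast
qed

section \<open>Pulling coverings back\<close>

locale quasi_isometric_embedding =
  M: Metric_space X d + M': Metric_space X' d'
  for X :: "'a set" and d :: "'a \<Rightarrow> 'a \<Rightarrow> real" and X' :: "'b set" and d' :: "'b \<Rightarrow> 'b \<Rightarrow> real" +
  fixes f :: "'a \<Rightarrow> 'b" and L c :: real
  assumes maps: "f \<in> X \<rightarrow> X'"
    and L_ge_1: "1 \<le> L"
    and c_nonneg: "0 \<le> c"
    and lower: "\<And>x y. x \<in> X \<Longrightarrow> y \<in> X \<Longrightarrow> (1 / L) * d x y - c \<le> d' (f x) (f y)"
    and upper: "\<And>x y. x \<in> X \<Longrightarrow> y \<in> X \<Longrightarrow> d' (f x) (f y) \<le> L * d x y + c"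
begin

definition pull :: "'b set \<Rightarrow> 'a set" where
  "pull A = {x \<in> X. f x \<in> A}"

text \<open>The radius grows by the factor \<open>2 * L\<close> and the separation shrinks by the
  same factor, so their ratio drops by \<open>4 * L\<^sup>2\<close>.\<close>

definition scale :: "real \<Rightarrow> real" where
  "scale \<rho> = \<rho> / (4 * L\<^sup>2)"

text \<open>Above this radius \<open>L r + c \<le> 2 L r\<close> and \<open>\<rho> r / L - c \<ge> \<rho> r / (2 L)\<close>, so that a
  \<open>\<rho> r\<close>-separated subset of an \<open>r\<close>-ball is mapped to a \<open>scale \<rho> (2 L r)\<close>-separated subset of a
  \<open>2 L r\<close>-ball. The summand 1 makes the radius positive, which gives injectivity.\<close>
definition pull_radius :: "(real \<Rightarrow> real) \<Rightarrow> real \<Rightarrow> real" where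
  "pull_radius R \<rho> = 1 + 2 * L * c / \<rho> + \<bar>R (scale \<rho>)\<bar>"

lemma scale_in: "\<rho> \<in> {0<..<1} \<Longrightarrow> scale \<rho> \<in> {0<..<1}"
proof -
  assume "\<rho> \<in> {0<..<1}"
  moreover have "1 \<le> L\<^sup>2"
    using L_ge_1 by (rule one_le_power)
  ultimately have "0 < \<rho>" "\<rho> < 4 * L\<^sup>2" "0 < 4 * L\<^sup>2"
    by auto
  then show ?thesis
    by (simp add: scale_def)
qed

lemma pull_radius_admissible: "pull_radius R \<in> admissible_radii"
  using L_ge_1 c_nonneg by (auto simp: admissible_radii_def pull_radius_def)

text \<open>The bound for \<open>A\<close> is applied to the image of \<open>S\<close>, which has as
  many points as \<open>S\<close>. The new radius function does not depend on \<open>A\<close>, so a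
  radius function common to all members of a covering stays common; the new counting function does
  not depend on \<open>R\<close>.\<close>

lemma NR_bounded_pull:
  assumes "A \<subseteq> X'" and bounded: "NR_bounded N R A d'"
  shows "NR_bounded (N \<circ> scale) (pull_radius R) (pull A) d"
  unfolding NR_bounded_def
proof (intro ballI allI impI)
  fix \<rho> a r S
  assume \<rho>: "\<rho> \<in> {0<..<1::real}" and a: "a \<in> pull A" and r: "pull_radius R \<rho> \<le> r"
    and S: "S \<subseteq> Metric_space.mball (pull A) d a r" and sep: "separated_by d (\<rho> * r) S"
  interpret P: Metric_space "pull A" d
    by (rule M.subspace) (auto simp: pull_def)
  interpret A: Metric_space A d'
    by (rule M'.subspace) fact
  have quot: "0 \<le> 2 * L * c / \<rho>"
    using \<rho> L_ge_1 c_nonneg by auto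
  have r1: "1 \<le> r" and r2: "2 * L * c / \<rho> \<le> r" and r3: "R (scale \<rho>) \<le> r"
    using r quot by (auto simp: pull_radius_def)
  \<comment> \<open>Used twice: it yields \<open>c \<le> L * r\<close> for the ball and
    \<open>c \<le> \<rho> * r / (2 * L)\<close> for the separation.\<close>
  have cr: "2 * L * c \<le> \<rho> * r"
    using r2 \<rho> by (simp add: field_simps)
  have "c \<le> 2 * L * c"
    using mult_right_mono[of 1 "2 * L" c] L_ge_1 c_nonneg by simp
  moreover have "\<rho> * r \<le> r" "r \<le> L * r"
    using mult_right_mono[of \<rho> 1 r] mult_right_mono[of 1 L r] \<rho> r1 L_ge_1 by auto
  ultimately have c_le: "c \<le> L * r" and r_le: "r \<le> 2 * L * r"
    using cr r1 by linarith+
  have S_X: "x \<in> X" "f x \<in> A" "d a x < r" if "x \<in> S" for x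
  proof -
    have "x \<in> pull A" "d a x < r"
      using S that by auto
    then show "x \<in> X" "f x \<in> A" "d a x < r"
      by (auto simp: pull_def)
  qed
  have ball: "f ` S \<subseteq> A.mball (f a) (2 * L * r)"
  proof
    fix y assume "y \<in> f ` S"
    then obtain x where x: "x \<in> S" "y = f x" by auto
    have "d' (f a) (f x) \<le> L * d a x + c"
      using upper a S_X[OF x(1)] by (auto simp: pull_def)
    also have "\<dots> < L * r + c"
      using S_X[OF x(1)] L_ge_1 by simp
    also have "\<dots> \<le> 2 * L * r"
      using c_le by simp
    finally show "y \<in> A.mball (f a) (2 * L * r)"
      using x a S_X by (auto simp: pull_def)
  qed
  have scale_eq: "scale \<rho> * (2 * L * r) = \<rho> * r / (2 * L)"
    using L_ge_1 by (simp add: scale_def field_simps power2_eq_square)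
  have far: "scale \<rho> * (2 * L * r) \<le> d' (f x) (f y)" if "x \<in> S" "y \<in> S" "x \<noteq> y" for x y
  proof -
    have "\<rho> * r \<le> d x y"
      using sep that by (auto simp: separated_by_def pairwise_def)
    then have "\<rho> * r / L \<le> (1 / L) * d x y"
      using L_ge_1 by (simp add: divide_right_mono)
    moreover have "c \<le> \<rho> * r / (2 * L)"
      using cr L_ge_1 by (simp add: field_simps)
    moreover have "\<rho> * r / L = \<rho> * r / (2 * L) + \<rho> * r / (2 * L)"
      using L_ge_1 by (simp add: field_simps)
    moreover have "(1 / L) * d x y - c \<le> d' (f x) (f y)"
      using lower S_X that by blast
    ultimately show ?thesis
      unfolding scale_eq by linarith
  qed
  have pos: "0 < scale \<rho> * (2 * L * r)"
    using \<rho> r1 L_ge_1 unfolding scale_eq by simp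
  have inj: "inj_on f S"
  proof (rule inj_onI, rule ccontr)
    fix x y assume "x \<in> S" "y \<in> S" "f x = f y" "x \<noteq> y"
    then show False
      using far[of x y] pos S_X[of y] by auto
  qed
  have "separated_by d' (scale \<rho> * (2 * L * r)) (f ` S)"
    using far by (auto simp: separated_by_def pairwise_def)
  moreover have "f a \<in> A"
    using a by (simp add: pull_def)
  moreover have "R (scale \<rho>) \<le> 2 * L * r"
    using r3 r_le by linarith
  ultimately have "finite (f ` S) \<and> card (f ` S) \<le> N (scale \<rho>)"
    using bounded scale_in[OF \<rho>] ball unfolding NR_bounded_def by blast
  then show "finite S \<and> card S \<le> (N \<circ> scale) \<rho>"
    using inj by (simp add: finite_image_iff card_image)
qed

lemma pull_Union: "pull (\<Union>\<V>) = \<Union>(pull ` \<V>)"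
  by (auto simp: pull_def)

text \<open>Preimages commute with unions, so a finite union of preimages is itself the preimage of
  a finite union, and the same \<open>N \<circ> scale\<close> serves it as serves the single
  members.\<close>

lemma uniformly_N_bounded_covering_pull:
  assumes "uniformly_N_bounded_covering N X' d' \<U>"
  shows "uniformly_N_bounded_covering (N \<circ> scale) X d (pull ` \<U>)"
  unfolding uniformly_N_bounded_covering_def
proof (intro conjI allI impI)
  have sub: "\<And>U. U \<in> \<U> \<Longrightarrow> U \<subseteq> X'" and cover: "\<Union>\<U> = X'"
    using assms by (auto simp: uniformly_N_bounded_covering_def covering_def)
  show "covering X (pull ` \<U>)"
    unfolding covering_def pull_Union[symmetric] cover using maps by (auto simp: pull_def)
  obtain R where "\<forall>U\<in>\<U>. NR_bounded N R U d'"
    using assms by (auto simp: uniformly_N_bounded_covering_def)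
  then have "\<forall>U\<in>pull ` \<U>. NR_bounded (N \<circ> scale) (pull_radius R) U d"
    using NR_bounded_pull sub by blast
  then show "\<exists>R\<in>admissible_radii. \<forall>U\<in>pull ` \<U>. NR_bounded (N \<circ> scale) R U d"
    using pull_radius_admissible by blast
next
  fix \<V> assume "\<V> \<subseteq> pull ` \<U>" "finite \<V>"
  \<comment> \<open>Different members can share a preimage, so a finite \<open>\<W>\<close> with
    image \<open>\<V>\<close> has to be chosen.\<close>
  then obtain \<W> where \<W>: "\<W> \<subseteq> \<U>" "finite \<W>" "\<V> = pull ` \<W>"
    by (meson finite_subset_image)
  then obtain R where "NR_bounded N R (\<Union>\<W>) d'"
    using assms unfolding uniformly_N_bounded_covering_def N_bounded_def by meson
  moreover have "\<Union>\<W> \<subseteq> X'"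
    using \<W>(1) assms by (auto simp: uniformly_N_bounded_covering_def covering_def)
  ultimately have "NR_bounded (N \<circ> scale) (pull_radius R) (\<Union>\<V>) d"
    unfolding \<W>(3) pull_Union[symmetric] by (intro NR_bounded_pull)
  then show "N_bounded (N \<circ> scale) (\<Union>\<V>) d"
    using pull_radius_admissible unfolding N_bounded_def by (rule bexI)
qed

text \<open>A point outside \<open>pull U\<close> is mapped outside \<open>U\<close>, and points
  closer than \<open>\<delta>\<close> have images closer than
  \<open>L * \<delta> + c\<close>.\<close>

lemma Lebesgue_num_pull:
  assumes \<delta>: "0 < \<delta>" and "ennreal (L * \<delta> + c + 1) \<le> Lebesgue_num X' d' \<U>"
  shows "ennreal \<delta> \<le> Lebesgue_num X d (pull ` \<U>)"
  unfolding Lebesgue_num_def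
proof (rule INF_greatest)
  fix x assume x: "x \<in> X"
  \<comment> \<open>The slack 1 makes the inequality strict, so that a single \<open>U\<close>
    exceeds the bound even if the supremum is not attained.\<close>
  have "ennreal (L * \<delta> + c) < ennreal (L * \<delta> + c + 1)"
    using \<delta> L_ge_1 c_nonneg by (intro ennreal_lessI) (auto intro: add_nonneg_pos)
  also have "\<dots> \<le> (SUP U\<in>\<U>. dist_to_set d' (f x) (X' - U))"
    using assms(2) maps x unfolding Lebesgue_num_def by (meson INF_lower PiE order_trans)
  finally obtain U where U: "U \<in> \<U>" "ennreal (L * \<delta> + c) < dist_to_set d' (f x) (X' - U)"
    by (auto simp: less_SUP_iff)
  have "ennreal \<delta> \<le> dist_to_set d x (X - pull U)"
    unfolding dist_to_set_def
  proof (intro INF_greatest ennreal_leI)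
    fix y assume y: "y \<in> X - pull U"
    then have "f y \<in> X' - U"
      using maps by (auto simp: pull_def)
    then have "ennreal (L * \<delta> + c) < ennreal (d' (f x) (f y))"
      using U(2) unfolding dist_to_set_def by (meson INF_lower less_le_trans)
    then have "L * \<delta> + c < d' (f x) (f y)"
      using \<delta> L_ge_1 c_nonneg by (subst (asm) ennreal_less_iff) auto
    also have "\<dots> \<le> L * d x y + c"
      using upper x y by auto
    finally show "\<delta> \<le> d x y"
      using L_ge_1 by simp
  qed
  then show "ennreal \<delta> \<le> (SUP U\<in>pull ` \<U>. dist_to_set d x (X - U))"
    using U(1) by (meson SUP_upper2 imageI)
qed

text \<open>The members through \<open>x\<close> are the preimages of the members through
  \<open>f x\<close>; coinciding preimages only lower the count.\<close>

lemma multiplicity_at_most_pull: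
  assumes "multiplicity_at_most m X' \<U>"
  shows "multiplicity_at_most m X (pull ` \<U>)"
  unfolding multiplicity_at_most_def
proof
  fix x assume x: "x \<in> X"
  let ?\<W> = "{U \<in> \<U>. f x \<in> U}"
  have "finite ?\<W>" "card ?\<W> \<le> m"
    using assms maps x by (auto simp: multiplicity_at_most_def)
  moreover have "{U \<in> pull ` \<U>. x \<in> U} = pull ` ?\<W>"
    using x by (auto simp: pull_def)
  ultimately show "finite {U \<in> pull ` \<U>. x \<in> U} \<and> card {U \<in> pull ` \<U>. x \<in> U} \<le> m"
    using card_image_le[of ?\<W> pull] by auto
qed

text \<open>Every \<open>n\<close> that works for \<open>X'\<close> works for \<open>X\<close>, as
  seen by using \<open>L * \<delta> + c + 1\<close> in \<open>X'\<close> for a given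
  \<open>\<delta>\<close>. The infimum over the larger set is smaller, also when a dimension is
  infinite.\<close>

lemma hypdim_le: "hypdim X d \<le> hypdim X' d'"
  unfolding hypdim_def
proof (rule Inf_superset_mono, safe)
  fix n
  assume n: "\<forall>\<delta>>0. \<exists>N \<U>. uniformly_N_bounded_covering N X' d' \<U> \<and>
     ennreal \<delta> \<le> Lebesgue_num X' d' \<U> \<and> multiplicity_at_most (n + 1) X' \<U>"
  have "\<exists>N \<U>. uniformly_N_bounded_covering N X d \<U> \<and>
     ennreal \<delta> \<le> Lebesgue_num X d \<U> \<and> multiplicity_at_most (n + 1) X \<U>" if \<delta>: "0 < \<delta>" for \<delta>
  proof -
    have "0 < L * \<delta> + c + 1"
      using \<delta> L_ge_1 c_nonneg by (simp add: add_nonneg_pos)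
    then show ?thesis
      using n uniformly_N_bounded_covering_pull Lebesgue_num_pull[OF \<delta>] multiplicity_at_most_pull
      by meson
  qed
  then show "\<exists>m. enat n = enat m \<and> (\<forall>\<delta>>0. \<exists>N \<U>. uniformly_N_bounded_covering N X d \<U> \<and>
     ennreal \<delta> \<le> Lebesgue_num X d \<U> \<and> multiplicity_at_most (m + 1) X \<U>)"
    by blast
qed

end

lemma hypdim_le_if_quasi_isometric:
  assumes "Metric_space X d" and "Metric_space X' d'" and "quasi_isometric X d X' d'"
  shows "hypdim X d \<le> hypdim X' d'"
proof -
  obtain f L c where "f \<in> X \<rightarrow> X'" "1 \<le> L" "0 \<le> c"
    "\<forall>x\<in>X. \<forall>y\<in>X. (1 / L) * d x y - c \<le> d' (f x) (f y) \<and> d' (f x) (f y) \<le> L * d x y + c"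
    using assms(3) unfolding quasi_isometric_def by blast
  then have "quasi_isometric_embedding X d X' d' f L c"
    by (intro quasi_isometric_embedding.intro[OF assms(1,2)] quasi_isometric_embedding_axioms.intro)
      auto
  then show ?thesis
    by (rule quasi_isometric_embedding.hypdim_le)
qed

theorem corollary4p2:
  fixes X :: "'a set" and d :: "'a \<Rightarrow> 'a \<Rightarrow> real"
    and X' :: "'b set" and d' :: "'b \<Rightarrow> 'b \<Rightarrow> real"
  assumes "Metric_space X d"
    and "Metric_space X' d'"
    and "quasi_isometric X d X' d'"
  shows "hypdim X d = hypdim X' d'"
  using hypdim_le_if_quasi_isometric[OF assms]
    hypdim_le_if_quasi_isometric[OF assms(2,1) quasi_isometric_sym[OF assms]]
  by (rule order_antisym)

end
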